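(* Let $n \geq 1$, let $A = \{a_1,a_2,\dots,a_n\}$ be a multiset of positive integers with $a_1 \geq a_2 \geq \dots \geq a_n$, and let $P = \{p_1,p_2,\dots,p_{2n}\}$ be a set of $2n$ integers with $p_1 < p_2 < \dots < p_{2n}$. If $P$ can be partitioned into the differences in $A$, then $$\sum_{i=1}^n a_i \equiv \sum_{i=1}^{2n} p_i \pmod 2,$$ and, for every $m \in \{1,\dots,n\}$, $$\sum_{i=1}^m a_i \leq \left(\sum_{i=2n+1-m}^{2n} p_i\right) - \left(\sum_{i=1}^m p_i\right).$$
   Context: "$P$ can be partitioned into the differences in $A$" means that the set $P$ can be partitioned into $n$ two-element subsets $\{s_i,t_i\}$, $i=1,\dots,n$, with $s_i - t_i = a_i$ for each $i$. *)

theory Defs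
  imports "HOL-Library.Multiset" "HOL-Library.Disjoint_Sets" "HOL-Number_Theory.Cong"
begin

text \<open>
  The labelling of the elements of \<open>A\<close> by \<open>1, \<dots>, n\<close> is existentially quantified, so the predicate
  depends only on the set \<open>P\<close> and the multiset \<open>A\<close>. Disjointness is of the indexed family, hence
  distinct indices carry distinct pairs even when the corresponding differences coincide.
\<close>

definition partitionable_into_differences :: "int set \<Rightarrow> int multiset \<Rightarrow> bool" where
  "partitionable_into_differences P A \<longleftrightarrow>
     (\<exists>n a s t. A = image_mset a (mset_set {1..n::nat})
        \<and> (\<forall>i\<in>{1..n}. s i \<noteq> t i \<and> s i - t i = a i)
        \<and> disjoint_family_on (\<lambda>i. {s i, t i}) {1..n}
        \<and> (\<Union>i\<in>{1..n}. {s i, t i}) = P)"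

end

theory Submission
  imports Defs "HOL-Combinatorics.Permutations"
begin

text \<open>
  Relabel the pairs of the partition so that the \<open>i\<close>-th pair realises the difference \<open>a i = s i - t i\<close>.
  Then \<open>(\<Sum>i\<le>n. a i)\<close> and the sum of \<open>P\<close>, which is \<open>(\<Sum>i\<le>n. s i + t i)\<close>, differ by the even number
  \<open>2 * (\<Sum>i\<le>n. t i)\<close>.  For the inequality, write \<open>(\<Sum>i\<le>m. a i) = (\<Sum>i\<le>m. s i) - (\<Sum>i\<le>m. t i)\<close>: the
  \<open>s i\<close> are \<open>m\<close> distinct elements of \<open>P\<close>, so their sum is at most that of the \<open>m\<close> largest
  elements, and the \<open>t i\<close> are \<open>m\<close> distinct elements of \<open>P\<close>, so their sum is at least that of the \<open>m\<close>
  smallest (\<open>sum_le_largest\<close>, \<open>sum_smallest_le\<close>).  Both extremal bounds come from one exchange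
  principle, \<open>sum_le_by_threshold\<close>, with the \<open>m\<close>-th largest or the \<open>m\<close>-th smallest element of \<open>P\<close>
  as the threshold.
\<close>

text \<open>
  Exchange principle: cancel the common part of \<open>S\<close> and \<open>T\<close>; the remainders have the same size, and
  the threshold \<open>c\<close> separates their elements.
\<close>

lemma sum_le_by_threshold:
  fixes c :: "'a :: linordered_idom"
  assumes "finite S" and "finite T" and card: "card S = card T"
    and lo: "\<And>x. x \<in> T - S \<Longrightarrow> f x \<le> c" and hi: "\<And>x. x \<in> S - T \<Longrightarrow> c \<le> f x"
  shows "sum f T \<le> sum f S"
proof -
  have card': "card (T - S) = card (S - T)"
    using card_le_sym_Diff[of S T] card_le_sym_Diff[of T S] assms(1-3) by simp
  have "sum f (T - S) \<le> of_nat (card (T - S)) * c"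
    using lo by (rule sum_bounded_above)
  also have "\<dots> = of_nat (card (S - T)) * c"
    by (simp only: card')
  also have "\<dots> \<le> sum f (S - T)"
    using hi by (rule sum_bounded_below)
  finally show ?thesis
    using sum.Int_Diff[OF assms(1), of f T] sum.Int_Diff[OF assms(2), of f S]
    by (simp add: Int_commute)
qed

lemma sum_smallest_le:
  fixes p :: "nat \<Rightarrow> 'a :: linordered_idom"
  assumes p: "strict_mono_on {1..N} p" and X: "X \<subseteq> p ` {1..N}" "card X = m"
    and m: "1 \<le> m" "m \<le> N"
  shows "(\<Sum>i=1..m. p i) \<le> \<Sum>X"
proof -
  have inj: "inj_on p {1..m}"
    using inj_on_subset[OF strict_mono_on_imp_inj_on[OF p]] m by auto
  have mono: "mono_on {1..N} p"
    using p by (rule strict_mono_on_imp_mono_on)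
  have "\<Sum>(p ` {1..m}) \<le> \<Sum>X"
  proof (rule sum_le_by_threshold)
    show "finite X"
      using X(1) by (rule finite_subset) simp
    show "card X = card (p ` {1..m})"
      using X(2) card_image[OF inj] by simp
    show "x \<le> p m" if "x \<in> p ` {1..m} - X" for x
      using that m by (auto intro!: mono_onD[OF mono])
    show "p m \<le> x" if x: "x \<in> X - p ` {1..m}" for x
    proof -
      obtain j where "j \<in> {1..N}" "x = p j" using x X(1) by auto
      moreover from this have "m < j" using x by (metis DiffE atLeastAtMost_iff imageI not_le)
      ultimately show ?thesis using m by (auto intro!: mono_onD[OF mono])
    qed
  qed simp
  then show ?thesis
    using sum.reindex[OF inj, of "\<lambda>x. x"] by simp
qed

lemma sum_le_largest:
  fixes p :: "nat \<Rightarrow> 'a :: linordered_idom"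
  assumes p: "strict_mono_on {1..N} p" and X: "X \<subseteq> p ` {1..N}" "card X = m"
    and m: "1 \<le> m" "m \<le> N"
  shows "\<Sum>X \<le> (\<Sum>i=N+1-m..N. p i)"
proof -
  let ?I = "{N+1-m..N}"
  have inj: "inj_on p ?I"
    using m by (intro inj_on_subset[OF strict_mono_on_imp_inj_on[OF p]]) auto
  have mono: "mono_on {1..N} p"
    using p by (rule strict_mono_on_imp_mono_on)
  have "\<Sum>X \<le> \<Sum>(p ` ?I)"
  proof (rule sum_le_by_threshold)
    show "finite X"
      using X(1) by (rule finite_subset) simp
    show "card (p ` ?I) = card X"
      using X(2) card_image[OF inj] m by simp
    show "p (N+1-m) \<le> x" if "x \<in> p ` ?I - X" for x
      using that m by (auto intro!: mono_onD[OF mono])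
    show "x \<le> p (N+1-m)" if x: "x \<in> X - p ` ?I" for x
    proof -
      obtain j where "j \<in> {1..N}" "x = p j" using x X(1) by auto
      moreover from this have "j < N+1-m" using x by (metis DiffE atLeastAtMost_iff imageI not_le)
      ultimately show ?thesis using m by (auto intro!: mono_onD[OF mono])
    qed
  qed simp
  then show ?thesis
    using sum.reindex[OF inj, of "\<lambda>x. x"] by simp
qed

text \<open>
  The definition provides some enumeration of the multiset of differences. Any other enumeration \<open>a\<close>
  differs from it by a permutation of the indices, along which the pairs can be carried.
\<close>

lemma partitionable_into_differences_enumerated:
  fixes a :: "nat \<Rightarrow> int"
  assumes "partitionable_into_differences P (image_mset a (mset_set {1..n}))"
  obtains s t where "\<And>i. i \<in> {1..n} \<Longrightarrow> s i \<noteq> t i" and "\<And>i. i \<in> {1..n} \<Longrightarrow> a i = s i - t i"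
    and "disjoint_family_on (\<lambda>i. {s i, t i}) {1..n}" and "P = (\<Union>i\<in>{1..n}. {s i, t i})"
proof -
  obtain n' b s t where b: "image_mset a (mset_set {1..n}) = image_mset b (mset_set {1..n'::nat})"
    and st: "\<forall>i\<in>{1..n'}. s i \<noteq> t i \<and> s i - t i = b i"
    and disj: "disjoint_family_on (\<lambda>i. {s i, t i}) {1..n'}"
    and P: "(\<Union>i\<in>{1..n'}. {s i, t i}) = P"
    using assms unfolding partitionable_into_differences_def by auto
  have n': "n' = n"
    using arg_cong[OF b, of size] by simp
  obtain \<pi> where \<pi>: "\<pi> permutes {1..n}" and ab: "\<forall>i\<in>{1..n}. a i = b (\<pi> i)"
    using image_mset_eq_implies_permutes[OF finite_atLeastAtMost b[unfolded n']] by blast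
  have \<pi>_in: "\<pi> i \<in> {1..n} \<longleftrightarrow> i \<in> {1..n}" for i
    using \<pi> by (rule permutes_in_image)
  show ?thesis
  proof (rule that)
    show "s (\<pi> i) \<noteq> t (\<pi> i)" "a i = s (\<pi> i) - t (\<pi> i)" if "i \<in> {1..n}" for i
      using st ab that \<pi>_in[of i] unfolding n' by auto
    show "disjoint_family_on (\<lambda>i. {s (\<pi> i), t (\<pi> i)}) {1..n}"
      unfolding disjoint_family_on_def
    proof (intro ballI impI)
      fix i j assume "i \<in> {1..n}" "j \<in> {1..n}" "i \<noteq> j"
      then have "\<pi> i \<in> {1..n}" "\<pi> j \<in> {1..n}" "\<pi> i \<noteq> \<pi> j"
        using \<pi>_in permutes_inj[OF \<pi>] by (auto dest: injD)
      then show "{s (\<pi> i), t (\<pi> i)} \<inter> {s (\<pi> j), t (\<pi> j)} = {}"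
        using disjoint_family_onD[OF disj[unfolded n']] by blast
    qed
    have "P = (\<Union>i\<in>\<pi> ` {1..n}. {s i, t i})"
      unfolding permutes_image[OF \<pi>] using P n' by simp
    then show "P = (\<Union>i\<in>{1..n}. {s (\<pi> i), t (\<pi> i)})"
      by (simp only: image_image)
  qed
qed

theorem theorem6:
  fixes n :: nat and A :: "int multiset" and P :: "int set"
    and a p :: "nat \<Rightarrow> int"
  assumes "n \<ge> 1"
    and "A = image_mset a (mset_set {1..n})"
    and "\<And>i. i \<in> {1..n} \<Longrightarrow> a i > 0"
    and "antimono_on {1..n} a"
    and "P = p ` {1..2*n}"
    and "strict_mono_on {1..2*n} p"
    and "partitionable_into_differences P A"
  shows "[(\<Sum>i=1..n. a i) = (\<Sum>i=1..2*n. p i)] (mod 2)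
    \<and> (\<forall>m\<in>{1..n}. (\<Sum>i=1..m. a i) \<le> (\<Sum>i=2*n+1-m..2*n. p i) - (\<Sum>i=1..m. p i))"
proof -
  obtain s t where ne: "\<And>i. i \<in> {1..n} \<Longrightarrow> s i \<noteq> t i"
    and a: "\<And>i. i \<in> {1..n} \<Longrightarrow> a i = s i - t i"
    and disj: "disjoint_family_on (\<lambda>i. {s i, t i}) {1..n}"
    and P: "P = (\<Union>i\<in>{1..n}. {s i, t i})"
    by (rule partitionable_into_differences_enumerated[OF assms(7)[unfolded assms(2)]]) (rule that)
  have inj_s: "inj_on s {1..n}" and inj_t: "inj_on t {1..n}"
    using disj unfolding disjoint_family_on_def inj_on_def by blast+
  have "(\<Sum>i=1..2*n. p i) = \<Sum>P"
    unfolding assms(5) using sum.reindex[OF strict_mono_on_imp_inj_on[OF assms(6)], of "\<lambda>x. x"] by simp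
  also have "\<dots> = (\<Sum>i=1..n. \<Sum>{s i, t i})"
    unfolding P using disj by (intro sum.UNION_disjoint) (auto simp: disjoint_family_on_def)
  also have "\<dots> = (\<Sum>i=1..n. s i + t i)"
    using ne by (intro sum.cong) auto
  also have "\<dots> = (\<Sum>i=1..n. a i + 2 * t i)"
    using a by (intro sum.cong) auto
  also have "\<dots> = (\<Sum>i=1..n. a i) + 2 * (\<Sum>i=1..n. t i)"
    by (simp add: sum.distrib sum_distrib_left)
  finally have "[(\<Sum>i=1..n. a i) = (\<Sum>i=1..2*n. p i)] (mod 2)"
    by (simp add: cong_def)
  moreover have "(\<Sum>i=1..m. a i) \<le> (\<Sum>i=2*n+1-m..2*n. p i) - (\<Sum>i=1..m. p i)" if m: "m \<in> {1..n}" for m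
  proof -
    have sub: "{1..m} \<subseteq> {1..n}"
      using m by auto
    note inj_sm = inj_on_subset[OF inj_s sub] and inj_tm = inj_on_subset[OF inj_t sub]
    have "s ` {1..m} \<subseteq> P" and "t ` {1..m} \<subseteq> P"
      using sub unfolding P by blast+
    then have s: "s ` {1..m} \<subseteq> p ` {1..2*n}" and t: "t ` {1..m} \<subseteq> p ` {1..2*n}"
      unfolding assms(5) .
    have "\<Sum>(s ` {1..m}) \<le> (\<Sum>i=2*n+1-m..2*n. p i)"
      using m card_image[OF inj_sm] by (intro sum_le_largest[OF assms(6) s]) simp_all
    moreover have "(\<Sum>i=1..m. p i) \<le> \<Sum>(t ` {1..m})"
      using m card_image[OF inj_tm] by (intro sum_smallest_le[OF assms(6) t]) simp_all
    moreover have "(\<Sum>i=1..m. a i) = \<Sum>(s ` {1..m}) - \<Sum>(t ` {1..m})"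
      unfolding sum.reindex[OF inj_sm] sum.reindex[OF inj_tm] sum_subtractf[symmetric]
      using a sub by (intro sum.cong) auto
    ultimately show ?thesis
      by linarith
  qed
  ultimately show ?thesis
    by blast
qed

end
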